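(* Let $\mathbb{F}_q$ be a finite field, let $n\ge 1$ and $t\ge 2$ be integers, let $A$ be a symmetric $n\times n$ matrix over $\mathbb{F}_q$ (i.e. $A^T=A$), and let $\lambda_1,\dots,\lambda_n$ be the eigenvalues of $A$. Let $f_1,\dots,f_{t-1}\in\mathbb{F}_q[x]$ and let $C$ be the linear code over $\mathbb{F}_q$ with generator matrix $(I_n\ f_1(A)\ f_2(A)\ \cdots\ f_{t-1}(A))$. Then: (1) Assume $\operatorname{char}\mathbb{F}_q$ is even. If there is a unique index $i$ ($1\le i\le n$) such that $f_1(\lambda_i)+f_2(\lambda_i)+\cdots+f_{t-1}(\lambda_i)=1$, then $C$ is a linear $[tn,n]$ code with one-dimensional Euclidean hull. (2) Assume $\operatorname{char}\mathbb{F}_q$ is odd. If there is a unique index $i$ ($1\le i\le n$) such that $f_1(\lambda_i)^2+f_2(\lambda_i)^2+\cdots+f_{t-1}(\lambda_i)^2=-1$, then $C$ is a linear $[tn,n]$ code with one-dimensional Euclidean hull. In particular, when $t=2$, if there is a unique index $i$ ($1\le i\le n$) such that $f_1(\lambda_i)\in\{\mu,-\mu\}$, where $\mu\in\mathbb{F}_{q^2}$ satisfies $\mu^2=-1$, then $C$ is a linear $[2n,n]$ code with one-dimensional Euclidean hull.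
   Context: $I_n$ is the $n\times n$ identity matrix. Eigenvalues are taken in an algebraic closure of $\mathbb{F}_q$ and listed with algebraic multiplicity (so uniqueness of the index $i$ counts multiplicity). An $[N,K]$ linear code over $\mathbb{F}_q$ is a $K$-dimensional subspace $C$ of $\mathbb{F}_q^N$. Its Euclidean dual is $C^{\perp_E}=\{y\in\mathbb{F}_q^N:\sum_{i=1}^N x_iy_i=0 \text{ for all } x\in C\}$ and its Euclidean hull is $C\cap C^{\perp_E}$. The code with generator matrix $G$ is the row space of $G$. *)

theory Defs
  imports
    "HOL-Algebra.Algebraic_Closure_Type"
    "Jordan_Normal_Form.Char_Poly"
    "Jordan_Normal_Form.VS_Connect"
begin

text \<open>An \<open>[N,K]\<close> code is represented by its set of codewords, a subset of
  \<^term>\<open>carrier_vec N\<close>.\<close>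

definition linear_code :: "nat \<Rightarrow> nat \<Rightarrow> 'a::field vec set \<Rightarrow> bool" where
  "linear_code N K C \<longleftrightarrow>
     VectorSpace.subspace class_ring C (module_vec TYPE('a) N) \<and>
     vectorspace.dim class_ring ((module_vec TYPE('a) N)\<lparr>carrier := C\<rparr>) = K"

definition euclidean_dual :: "nat \<Rightarrow> 'a::field vec set \<Rightarrow> 'a vec set" where
  "euclidean_dual N C = {y \<in> carrier_vec N. \<forall>x\<in>C. x \<bullet> y = 0}"

definition euclidean_hull :: "nat \<Rightarrow> 'a::field vec set \<Rightarrow> 'a vec set" where
  "euclidean_hull N C = C \<inter> euclidean_dual N C"

definition code_of_generator :: "'a::field mat \<Rightarrow> 'a vec set" where
  "code_of_generator G = vec_space.row_space (dim_col G) G"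

text \<open>Evaluation of a polynomial at a square matrix, with \<open>A\<^sup>0\<close> the identity matrix.\<close>

definition poly_mat :: "'a::comm_ring_1 poly \<Rightarrow> 'a mat \<Rightarrow> 'a mat" where
  "poly_mat p A = mat (dim_row A) (dim_row A)
     (\<lambda>(i,j). \<Sum>k\<le>degree p. coeff p k * (A ^\<^sub>m k) $$ (i,j))"

text \<open>The block row \<open>(B\<^sub>0 B\<^sub>1 \<dots>)\<close> of a list of \<open>n \<times> n\<close> matrices.\<close>

definition block_row :: "nat \<Rightarrow> 'a mat list \<Rightarrow> 'a mat" where
  "block_row n Bs = mat n (length Bs * n) (\<lambda>(i,j). (Bs ! (j div n)) $$ (i, j mod n))"

definition generator_matrix :: "nat \<Rightarrow> nat \<Rightarrow> (nat \<Rightarrow> 'a::field poly) \<Rightarrow> 'a mat \<Rightarrow> 'a mat" where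
  "generator_matrix n t f A = block_row n (1\<^sub>m n # map (\<lambda>k. poly_mat (f k) A) [1..<t])"

definition poly_ac :: "'a::field poly \<Rightarrow> 'a alg_closure \<Rightarrow> 'a alg_closure" where
  "poly_ac p x = poly (map_poly to_ac p) x"

text \<open>The field with \<open>q\<^sup>2\<close> elements, where \<open>q = card (UNIV :: 'a set)\<close>, as the subfield of the algebraic
  closure that consists of the roots of \<open>X\<^bsup>q\<^sup>2\<^esup> - X\<close>.\<close>

definition quadratic_extension :: "'a::{field,finite} alg_closure set" where
  "quadratic_extension = {x. x ^ (card (UNIV :: 'a set) ^ 2) = x}"

text \<open>The sequence \<open>lam 1, \<dots>, lam n\<close> lists the eigenvalues of the \<open>n \<times> n\<close> matrix \<open>A\<close> in the
  algebraic closure, each one as often as its algebraic multiplicity.\<close>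

definition lists_eigenvalues :: "nat \<Rightarrow> 'a::field mat \<Rightarrow> (nat \<Rightarrow> 'a alg_closure) \<Rightarrow> bool" where
  "lists_eigenvalues n A lam \<longleftrightarrow>
     char_poly (map_mat to_ac A) = (\<Prod>i=1..n. [:- lam i, 1:])"

end

(*
  For a generator matrix G whose rows are independent, the hull consists of the words v G with
  (G G^T) v = 0, so its dimension is that of the kernel of S = G G^T = I + f_1(A)^2 + ... + f_{t-1}(A)^2.
  Over the algebraic closure A is similar to an upper triangular matrix whose diagonal lists the
  eigenvalues in any prescribed order, and the same change of basis makes S upper triangular with
  diagonal entries g(lambda_i), g = 1 + f_1^2 + ... + f_{t-1}^2. Placing the unique zero of g first,
  back substitution shows that ker S is a line over the closure; proportionality of two vectors
  over the base field, and the vanishing of det S, descend from the closure. In characteristic 2,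
  g = (1 + f_1 + ... + f_{t-1})^2.
*)
theory Submission
  imports Defs "Jordan_Normal_Form.DL_Rank" "Jordan_Normal_Form.Schur_Decomposition"
begin

section \<open>Codes as ranges of injective matrices\<close>

lemma mult_mat_unit_vec:
  fixes A :: "'a::semiring_1 mat"
  assumes "A \<in> carrier_mat nr nc" and "j < nc"
  shows "A *\<^sub>v unit_vec nc j = col A j"
  using assms by (intro eq_vecI) auto

lemma nonzero_vec_entry:
  fixes v :: "'a::zero vec"
  assumes "v \<in> carrier_vec n" and "v \<noteq> 0\<^sub>v n"
  obtains i where "i < n" "v $ i \<noteq> 0"
proof -
  have "\<exists>i<n. v $ i \<noteq> 0"
  proof (rule ccontr)
    assume "\<not> ?thesis"
    then have "v = 0\<^sub>v n" using assms(1) by (intro eq_vecI) auto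
    then show False using assms(2) by blast
  qed
  then show ?thesis using that by blast
qed

text \<open>The range is the column space, and injectivity is independence of the columns, so the
  rank is \<open>k\<close>. Independence is a property of the set of columns, which forgets
  repetitions; hence distinctness comes first: two equal columns would put a difference of unit
  vectors into the kernel.\<close>

lemma linear_code_range:
  fixes M :: "'a::field mat"
  assumes M: "M \<in> carrier_mat N k"
    and inj: "\<And>x. x \<in> carrier_vec k \<Longrightarrow> M *\<^sub>v x = 0\<^sub>v N \<Longrightarrow> x = 0\<^sub>v k"
  shows "linear_code N k {M *\<^sub>v x |x. x \<in> carrier_vec k}"
proof -
  interpret vec_space "TYPE('a)" N .
  have cols: "set (cols M) \<subseteq> carrier_vec N"
    using M cols_dim by blast
  have dist: "distinct (cols M)"
  proof (unfold distinct_conv_nth, intro allI impI notI)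
    fix i j assume i: "i < length (cols M)" and j: "j < length (cols M)" and ij: "i \<noteq> j"
      and eq: "cols M ! i = cols M ! j"
    have ik: "i < k" and jk: "j < k" using i j M by auto
    have "M *\<^sub>v (unit_vec k i - unit_vec k j) = M *\<^sub>v unit_vec k i - M *\<^sub>v unit_vec k j"
      using M by (simp add: mult_minus_distrib_mat_vec)
    also have "\<dots> = 0\<^sub>v N"
      using M ik jk eq by (simp add: mult_mat_unit_vec)
    finally have "unit_vec k i - unit_vec k j = (0\<^sub>v k :: 'a vec)"
      by (intro inj) auto
    then have "(unit_vec k i - unit_vec k j :: 'a vec) $ i = 0"
      using ik by simp
    then show False using ik jk ij by simp
  qed
  have "lin_indpt (set (cols M))"
    using lin_depE[OF M _ dist] inj by blast
  then have "rank M = k"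
    using lin_indpt_full_rank[OF M dist] by blast
  moreover have "{M *\<^sub>v x |x. x \<in> carrier_vec k} = span (set (cols M))"
    using col_space_eq[OF M] M unfolding col_space_def by auto
  moreover have "VectorSpace.subspace class_ring (span (set (cols M))) V"
    using span_is_subspace cols by auto
  ultimately show ?thesis
    unfolding linear_code_def rank_def by simp
qed

section \<open>Triangularization over a field that contains all eigenvalues\<close>

lemma invertible_with_first_column:
  fixes v :: "'a::field vec"
  assumes v: "v \<in> carrier_vec n" and v0: "v \<noteq> 0\<^sub>v n"
  obtains P Q where "P \<in> carrier_mat n n" "Q \<in> carrier_mat n n"
    "P * Q = 1\<^sub>m n" "Q * P = 1\<^sub>m n" "col P 0 = v"
proof -
  interpret vec_space "TYPE('a)" n .
  define ws where "ws = basis_completion v"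
  define P where "P = mat_of_cols n ws"
  note bc = basis_completion[OF v v0, folded ws_def]
  have n: "n \<noteq> 0" using v v0 by auto
  have P: "P \<in> carrier_mat n n" using bc unfolding P_def by auto
  have colsP: "cols P = ws" unfolding P_def using bc by (intro cols_mat_of_cols) auto
  have "rank P = n" using lin_indpt_full_rank[OF P] bc colsP by simp
  then have "det P \<noteq> 0" using det_rank_iff[OF P] by simp
  then obtain Q where Q: "Q \<in> carrier_mat n n" "Q * P = 1\<^sub>m n"
    using det_non_zero_imp_unit[OF P, of "()"] P
    unfolding Units_def ring_mat_def by auto
  then have "P * Q = 1\<^sub>m n" using mat_mult_left_right_inverse P by blast
  moreover have "col P 0 = v"
    using bc n colsP P by (metis carrier_matD(2) cols_nth hd_conv_nth list.size(3) not_gr_zero)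
  ultimately show ?thesis using that P Q by blast
qed

text \<open>The Schur decomposition in \<open>Jordan_Normal_Form\<close> goes through Gram-Schmidt and needs a
  conjugatable ordered field, which the algebraic closure of a finite field is not.\<close>

lemma triangularization:
  fixes A :: "'a::field mat"
  assumes "A \<in> carrier_mat n n" and "char_poly A = (\<Prod>e\<leftarrow>es. [:- e, 1:])"
  shows "\<exists>T P Q. similar_mat_wit A T P Q \<and> upper_triangular T \<and> diag_mat T = es"
  using assms
proof (induction es arbitrary: n A)
  \<comment> \<open>The empty product is 1, while \<open>char_poly A\<close> has degree
    \<open>n\<close>; so \<open>n = 0\<close>.\<close>
  case Nil
  then show ?case using degree_monic_char_poly[of A n]
    by (intro exI[of _ A] exI[of _ "1\<^sub>m n"]) (auto intro: similar_mat_wit_refl simp: diag_mat_def)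
next
  case (Cons e es)
  note A = Cons.prems(1)
  have cp: "char_poly A = [:- e, 1:] * (\<Prod>e\<leftarrow>es. [:- e, 1:])"
    using Cons.prems(2) by simp
  have "eigenvalue A e"
    unfolding eigenvalue_root_char_poly[OF A] cp by simp
  then obtain v where v: "v \<in> carrier_vec n" "v \<noteq> 0\<^sub>v n" and Av: "A *\<^sub>v v = e \<cdot>\<^sub>v v"
    using A unfolding eigenvalue_def eigenvector_def by auto
  then obtain W W' where W: "W \<in> carrier_mat n n" and W': "W' \<in> carrier_mat n n"
    and WW': "W * W' = 1\<^sub>m n" and W'W: "W' * W = 1\<^sub>m n" and colW: "col W 0 = v"
    using invertible_with_first_column by blast
  have n: "n \<noteq> 0" using v by auto
  then obtain m where m: "n = Suc m" by (cases n) auto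
  \<comment> \<open>In the basis \<open>W\<close> the first vector is an eigenvector, so the first
    column of \<open>A'\<close> is \<open>e\<close> times a unit vector and its lower left block
    vanishes.\<close>
  define A' where "A' = W' * A * W"
  have A': "A' \<in> carrier_mat n n" using W W' A unfolding A'_def by auto
  have wit: "similar_mat_wit A' A W' W"
    by (rule similar_mat_witI[of _ _ n]) (use W W' A WW' W'W in \<open>auto simp: A'_def\<close>)
  have "col A' 0 = col (W' * (A * W)) 0"
    unfolding A'_def using W W' A by (simp add: assoc_mult_mat[of _ n n _ n _ n])
  also have "\<dots> = W' *\<^sub>v (A *\<^sub>v v)"
    using col_mult2[OF W' mult_carrier_mat[OF A W]] col_mult2[OF A W] n colW by simp
  also have "\<dots> = e \<cdot>\<^sub>v (W' *\<^sub>v col W 0)"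
    unfolding Av colW using W' v by auto
  also have "W' *\<^sub>v col W 0 = col (W' * W) 0"
    using col_mult2[OF W' W] n by simp
  also have "\<dots> = unit_vec n 0"
    using W'W n by simp
  finally have col0: "col A' 0 = e \<cdot>\<^sub>v unit_vec n 0" .
  obtain A1 A2 A0 A3 where split: "split_block A' 1 1 = (A1, A2, A0, A3)"
    by (cases "split_block A' 1 1") auto
  have "dim_row A' = 1 + m" "dim_col A' = 1 + m" using A' m by auto
  note block = split_block[OF split this]
  have entry: "A' $$ (i, 0) = (if i = 0 then e else 0)" if "i < n" for i
    using arg_cong[OF col0, of "\<lambda>v :: 'a vec. v $ i"] that A' n by auto
  have A1: "A1 = mat 1 1 (\<lambda>_. e)"
    using split[unfolded split_block_def Let_def] entry n by auto
  have A0: "A0 = 0\<^sub>m m 1"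
    using split[unfolded split_block_def Let_def] entry A' m by auto
  \<comment> \<open>Cancelling the factor that belongs to \<open>e\<close> leaves for
    \<open>A3\<close> exactly the product over \<open>es\<close> that the induction hypothesis asks
    for.\<close>
  have cpA': "char_poly A' = char_poly A1 * char_poly A3"
    unfolding block(5) A0 using block A1
    by (intro char_poly_four_block_zeros_col) auto
  moreover have "char_poly A1 = [:- e, 1:]"
    by (simp add: A1 char_poly_defs det_def sign_def)
  moreover have "char_poly A' = char_poly A"
    using wit char_poly_similar unfolding similar_mat_def by blast
  ultimately have "[:- e, 1:] * char_poly A3 = [:- e, 1:] * (\<Prod>e\<leftarrow>es. [:- e, 1:])"
    using cp by simp
  then have "char_poly A3 = (\<Prod>e\<leftarrow>es. [:- e, 1:])"
    by (subst (asm) mult_left_cancel) auto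
  with Cons.IH[OF block(4)] obtain T P Q where
    IH: "similar_mat_wit A3 T P Q" "upper_triangular T" "diag_mat T = es" by blast
  note T = similar_mat_witD2[OF block(4) IH(1)]
  \<comment> \<open>The second change of basis acts on the last \<open>m\<close> coordinates only,
    by \<open>P\<close>; this multiplies the upper right block by \<open>P\<close> from the
    right.\<close>
  define C where "C = four_block_mat A1 (A2 * P) A0 T"
  have URA: "A2 = 1\<^sub>m 1 * (A2 * P) * Q"
    using block(2) T by (simp add: assoc_mult_mat[of _ 1 m _ m _ m])
  have LLA: "A0 = P * A0 * 1\<^sub>m 1" unfolding A0 using T by auto
  have wit': "similar_mat_wit A' C (four_block_mat (1\<^sub>m 1) (0\<^sub>m 1 m) (0\<^sub>m m 1) P)
      (four_block_mat (1\<^sub>m 1) (0\<^sub>m 1 m) (0\<^sub>m m 1) Q)"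
    unfolding block(5) C_def
    by (rule similar_mat_wit_four_block[OF similar_mat_wit_refl IH(1) URA LLA])
      (use block T in auto)
  have "upper_triangular C"
    unfolding C_def A0
    by (rule upper_triangular_four_block[OF block(1) T(5)]) (use IH A1 in auto)
  moreover have "diag_mat C = e # es"
    unfolding C_def using diag_four_block_mat[OF block(1) T(5)] IH(3)
    by (simp add: A1 diag_mat_def)
  ultimately show ?case
    using similar_mat_wit_trans[OF similar_mat_wit_sym[OF wit] wit'] by blast
qed

section \<open>Kernels of triangularizable matrices\<close>

text \<open>Back substitution from the last row upwards: once the entries of \<open>w\<close> beyond
  \<open>i\<close> vanish, row \<open>i\<close> reads \<open>T $$ (i,i) * w $ i = 0\<close>. The
  corner entry of \<open>T\<close> may be zero, so \<open>w $ 0\<close> stays free.\<close>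

lemma upper_triangular_kernel:
  fixes T :: "'a::idom mat" and w :: "'a vec"
  assumes T: "T \<in> carrier_mat n n" and ut: "upper_triangular T"
    and diag: "\<And>i. 0 < i \<Longrightarrow> i < n \<Longrightarrow> T $$ (i,i) \<noteq> 0"
    and w: "w \<in> carrier_vec n" and Tw: "T *\<^sub>v w = 0\<^sub>v n"
    and i: "0 < i" "i < n"
  shows "w $ i = 0"
  using i
proof (induction "n - i" arbitrary: i rule: less_induct)
  case less
  have "0 = (T *\<^sub>v w) $ i" using Tw less.prems by simp
  also have "\<dots> = (\<Sum>j<n. T $$ (i,j) * w $ j)"
    using T w less.prems by (simp add: scalar_prod_def atLeast0LessThan)
  also have "\<dots> = (\<Sum>j<n. if j = i then T $$ (i,i) * w $ i else 0)"
  proof (rule sum.cong[OF refl])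
    fix j assume j: "j \<in> {..<n}"
    consider "j < i" | "j = i" | "i < j" by linarith
    then show "T $$ (i,j) * w $ j = (if j = i then T $$ (i,i) * w $ i else 0)"
    proof cases
      case 1
      then show ?thesis using upper_triangularD[OF ut] T less.prems by auto
    next
      case 3
      then show ?thesis using less.hyps[of j] j less.prems by auto
    qed simp
  qed
  also have "\<dots> = T $$ (i,i) * w $ i" using less.prems by simp
  finally show ?case using diag less.prems by auto
qed

text \<open>The coordinate vector \<open>Q *\<^sub>v x\<close> of a kernel vector \<open>x\<close>
  is supported at 0, so \<open>x\<close> is a multiple of \<open>col P 0\<close>. The conclusion
  compares two kernel vectors instead, because proportionality to a given \<open>v\<close> can be
  carried back to a subfield, whereas \<open>P\<close> cannot.\<close>

lemma kernel_similar_upper_triangular: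
  fixes M T P Q :: "'a::field mat" and u v :: "'a vec"
  assumes wit: "similar_mat_wit M T P Q" and M: "M \<in> carrier_mat n n"
    and ut: "upper_triangular T"
    and diag: "\<And>i. 0 < i \<Longrightarrow> i < n \<Longrightarrow> T $$ (i,i) \<noteq> 0"
    and u: "u \<in> carrier_vec n" "M *\<^sub>v u = 0\<^sub>v n"
    and v: "v \<in> carrier_vec n" "M *\<^sub>v v = 0\<^sub>v n" "v \<noteq> 0\<^sub>v n"
  shows "\<exists>c. u = c \<cdot>\<^sub>v v"
proof -
  note w = similar_mat_witD2[OF M wit]
  have n: "0 < n" using v by (cases n) auto
  have T_eq: "T = Q * M * P"
    using similar_mat_witD(3)[OF refl similar_mat_wit_sym[OF wit]] .
  have multiple: "x = (Q *\<^sub>v x) $ 0 \<cdot>\<^sub>v col P 0"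
    if x: "x \<in> carrier_vec n" "M *\<^sub>v x = 0\<^sub>v n" for x
  proof -
    have Qx: "Q *\<^sub>v x \<in> carrier_vec n" using w x by auto
    have PQx: "P *\<^sub>v (Q *\<^sub>v x) = x"
      using w x by (simp flip: assoc_mult_mat_vec)
    have "T *\<^sub>v (Q *\<^sub>v x) = Q *\<^sub>v (M *\<^sub>v (P *\<^sub>v (Q *\<^sub>v x)))"
      unfolding T_eq using w M Qx by (simp add: assoc_mult_mat_vec[of _ n n _ n])
    also have "\<dots> = 0\<^sub>v n" unfolding PQx x(2) using w by auto
    finally have "(Q *\<^sub>v x) $ i = 0" if "0 < i" "i < n" for i
      using upper_triangular_kernel[OF w(5) ut diag Qx] that by blast
    then have "Q *\<^sub>v x = (Q *\<^sub>v x) $ 0 \<cdot>\<^sub>v unit_vec n 0"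
      using Qx w by (intro eq_vecI) auto
    then have "P *\<^sub>v (Q *\<^sub>v x) = (Q *\<^sub>v x) $ 0 \<cdot>\<^sub>v (P *\<^sub>v unit_vec n 0)"
      using w(6) by (metis mult_mat_vec unit_vec_carrier)
    then show ?thesis
      using PQx w(6) n by (simp add: mult_mat_unit_vec)
  qed
  define a b where "a = (Q *\<^sub>v u) $ 0" and "b = (Q *\<^sub>v v) $ 0"
  have ua: "u = a \<cdot>\<^sub>v col P 0" and vb: "v = b \<cdot>\<^sub>v col P 0"
    unfolding a_def b_def using multiple u v by auto
  have "b \<noteq> 0" using vb v w by auto
  then have "u = (a / b) \<cdot>\<^sub>v v" unfolding ua vb by (simp add: smult_smult_assoc)
  then show ?thesis ..
qed

section \<open>Polynomials in a matrix, triangular in one common basis\<close>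

text \<open>On and below the diagonal, a nonzero term of the product needs
  \<open>i \<le> m \<le> j \<le> i\<close>, which leaves only the product of the diagonal
  entries.\<close>

lemma upper_triangular_mult:
  fixes S T :: "'a::semiring_0 mat"
  assumes S: "S \<in> carrier_mat n n" "upper_triangular S"
    and T: "T \<in> carrier_mat n n" "upper_triangular T"
  shows "upper_triangular (S * T)"
    and "i < n \<Longrightarrow> (S * T) $$ (i,i) = S $$ (i,i) * T $$ (i,i)"
proof -
  have entry: "(S * T) $$ (i,j) = (if i = j then S $$ (i,i) * T $$ (i,i) else 0)"
    if "i < n" "j < n" "j \<le> i" for i j
  proof -
    have "(S * T) $$ (i,j) = (\<Sum>m<n. S $$ (i,m) * T $$ (m,j))"
      using S T that by (simp add: scalar_prod_def atLeast0LessThan)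
    also have "\<dots> = (\<Sum>m<n. if m = i then (if i = j then S $$ (i,i) * T $$ (i,i) else 0) else 0)"
    proof (rule sum.cong[OF refl])
      fix m assume m: "m \<in> {..<n}"
      consider "m < i" | "m = i" | "i < m" by linarith
      then show "S $$ (i,m) * T $$ (m,j) =
        (if m = i then (if i = j then S $$ (i,i) * T $$ (i,i) else 0) else 0)"
      proof cases
        case 1
        then show ?thesis using upper_triangularD[OF S(2)] S that by auto
      next
        case 2
        then show ?thesis using upper_triangularD[OF T(2)] T that
          by (cases "i = j") auto
      next
        case 3
        then show ?thesis using upper_triangularD[OF T(2)] T that m by auto
      qed
    qed
    finally show ?thesis using that by simp
  qed
  show "upper_triangular (S * T)"
    using entry S T by (intro upper_triangularI) auto
  show "(S * T) $$ (i,i) = S $$ (i,i) * T $$ (i,i)" if "i < n"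
    using entry that by simp
qed

text \<open>The basis change \<open>P\<close>, \<open>Q\<close> is a parameter rather than
  existentially bound: triangular forms can be added and multiplied only if they come from the same
  basis. Keeping the order of the diagonal in \<open>d\<close> is what matches values of different
  polynomials at the same eigenvalue.\<close>

definition triangular_in_basis ::
    "nat \<Rightarrow> 'a::comm_ring_1 mat \<Rightarrow> 'a mat \<Rightarrow> 'a mat \<Rightarrow> (nat \<Rightarrow> 'a) \<Rightarrow> bool" where
  "triangular_in_basis n P Q M d \<longleftrightarrow>
     (\<exists>T. similar_mat_wit M T P Q \<and> M \<in> carrier_mat n n \<and> upper_triangular T \<and>
       (\<forall>i<n. T $$ (i,i) = d i))"

lemma triangular_in_basis_mult:
  assumes "triangular_in_basis n P Q M d" and "triangular_in_basis n P Q N e"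
  shows "triangular_in_basis n P Q (M * N) (\<lambda>i. d i * e i)"
proof -
  obtain S T where S: "similar_mat_wit M S P Q" "upper_triangular S" "\<forall>i<n. S $$ (i,i) = d i"
    and T: "similar_mat_wit N T P Q" "upper_triangular T" "\<forall>i<n. T $$ (i,i) = e i"
    and M: "M \<in> carrier_mat n n" and N: "N \<in> carrier_mat n n"
    using assms unfolding triangular_in_basis_def by auto
  note s = similar_mat_witD2[OF M S(1)] and t = similar_mat_witD2[OF N T(1)]
  have "M * N = P * S * (Q * P) * T * Q"
    unfolding s(3) t(3) using s(5-7) t(5)
    by (simp add: assoc_mult_mat[of _ n n _ n _ n])
  also have "\<dots> = P * (S * T) * Q"
    unfolding s(2) using s t by (simp add: assoc_mult_mat[of _ n n _ n _ n])
  finally have "similar_mat_wit (M * N) (S * T) P Q"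
    using s t by (intro similar_mat_witI[of _ _ n]) auto
  then show ?thesis
    unfolding triangular_in_basis_def
    using upper_triangular_mult[OF s(5) S(2) t(5) T(2)] S T M N by auto
qed

lemma triangular_in_basis_add:
  assumes "triangular_in_basis n P Q M d" and "triangular_in_basis n P Q N e"
  shows "triangular_in_basis n P Q (M + N) (\<lambda>i. d i + e i)"
proof -
  obtain S T where S: "similar_mat_wit M S P Q" "upper_triangular S" "\<forall>i<n. S $$ (i,i) = d i"
    and T: "similar_mat_wit N T P Q" "upper_triangular T" "\<forall>i<n. T $$ (i,i) = e i"
    and M: "M \<in> carrier_mat n n" and N: "N \<in> carrier_mat n n"
    using assms unfolding triangular_in_basis_def by auto
  note s = similar_mat_witD2[OF M S(1)] and t = similar_mat_witD2[OF N T(1)]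
  have "M + N = P * (S + T) * Q"
    using s t by (simp add: mult_add_distrib_mat[of _ n n _ n] add_mult_distrib_mat[of _ n n _ _ n])
  then have "similar_mat_wit (M + N) (S + T) P Q"
    using s t by (intro similar_mat_witI[of _ _ n]) auto
  moreover have "upper_triangular (S + T)"
    using upper_triangularD[OF S(2)] upper_triangularD[OF T(2)] s t
    by (intro upper_triangularI) auto
  ultimately show ?thesis
    unfolding triangular_in_basis_def using S T s t by auto
qed

lemma triangular_in_basis_smult:
  assumes "triangular_in_basis n P Q M d"
  shows "triangular_in_basis n P Q (c \<cdot>\<^sub>m M) (\<lambda>i. c * d i)"
proof -
  obtain S where S: "similar_mat_wit M S P Q" "upper_triangular S" "\<forall>i<n. S $$ (i,i) = d i"
    and M: "M \<in> carrier_mat n n"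
    using assms unfolding triangular_in_basis_def by auto
  note s = similar_mat_witD2[OF M S(1)]
  have "upper_triangular (c \<cdot>\<^sub>m S)"
    using upper_triangularD[OF S(2)] s by (intro upper_triangularI) auto
  then show ?thesis
    unfolding triangular_in_basis_def
    by (intro exI[of _ "c \<cdot>\<^sub>m S"] conjI similar_mat_wit_smult[OF S(1)]) (use S(3) s in auto)
qed

lemma triangular_in_basis_one:
  assumes "P \<in> carrier_mat n n" "Q \<in> carrier_mat n n" "P * Q = 1\<^sub>m n" "Q * P = 1\<^sub>m n"
  shows "triangular_in_basis n P Q (1\<^sub>m n) (\<lambda>i. 1)"
  unfolding triangular_in_basis_def
  by (intro exI[of _ "1\<^sub>m n"] conjI similar_mat_witI[of _ _ n]) (use assms in auto)

text \<open>The sum is taken entrywise because both \<open>poly_mat\<close> and the product of a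
  block row with its transpose come in this form.\<close>

lemma triangular_in_basis_sum:
  assumes PQ: "P \<in> carrier_mat n n" "Q \<in> carrier_mat n n" "P * Q = 1\<^sub>m n" "Q * P = 1\<^sub>m n"
    and "finite K" and "\<And>k. k \<in> K \<Longrightarrow> triangular_in_basis n P Q (M k) (d k)"
  shows "triangular_in_basis n P Q (mat n n (\<lambda>(i,j). \<Sum>k\<in>K. M k $$ (i,j))) (\<lambda>i. \<Sum>k\<in>K. d k i)"
  using assms(5,6)
proof (induction K rule: finite_induct)
  case empty
  have zero: "mat n n (\<lambda>(i,j). \<Sum>k\<in>{}. M k $$ (i,j)) = 0 \<cdot>\<^sub>m 1\<^sub>m n" by (intro eq_matI) auto
  show ?case
    unfolding zero using triangular_in_basis_smult[OF triangular_in_basis_one[OF PQ], of 0] by simp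
next
  case (insert k K)
  have "M k \<in> carrier_mat n n"
    using insert.prems unfolding triangular_in_basis_def by auto
  then have step: "mat n n (\<lambda>(i,j). \<Sum>k\<in>insert k K. M k $$ (i,j)) =
      M k + mat n n (\<lambda>(i,j). \<Sum>k\<in>K. M k $$ (i,j))"
    using insert.hyps by (intro eq_matI) auto
  have "triangular_in_basis n P Q (M k + mat n n (\<lambda>(i,j). \<Sum>k\<in>K. M k $$ (i,j)))
      (\<lambda>i. d k i + (\<Sum>k\<in>K. d k i))"
    by (rule triangular_in_basis_add[OF _ insert.IH]) (use insert.prems in blast)+
  then show ?case
    unfolding step by (simp only: sum.insert[OF insert.hyps])
qed

text \<open>Powers, scalar multiples and sums stay triangular in the fixed basis and act on the
  diagonal entry by entry, so the diagonal undergoes the same polynomial.\<close>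

lemma triangular_in_basis_poly_mat:
  assumes PQ: "P \<in> carrier_mat n n" "Q \<in> carrier_mat n n" "P * Q = 1\<^sub>m n" "Q * P = 1\<^sub>m n"
    and M: "triangular_in_basis n P Q M d"
  shows "triangular_in_basis n P Q (poly_mat p M) (\<lambda>i. poly p (d i))"
proof -
  have carrier: "M \<in> carrier_mat n n"
    using M unfolding triangular_in_basis_def by auto
  have pow: "triangular_in_basis n P Q (M ^\<^sub>m k) (\<lambda>i. d i ^ k)" for k
  proof (induction k)
    case 0
    then show ?case using triangular_in_basis_one[OF PQ] carrier by simp
  next
    case (Suc k)
    then show ?case using triangular_in_basis_mult[OF Suc M] by (simp add: mult.commute)
  qed
  have "poly_mat p M = mat n n (\<lambda>(i,j). \<Sum>k\<le>degree p. (coeff p k \<cdot>\<^sub>m M ^\<^sub>m k) $$ (i,j))"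
    unfolding poly_mat_def using carrier by (intro eq_matI) auto
  then show ?thesis
    using triangular_in_basis_sum[OF PQ finite_atMost, of "degree p"
        "\<lambda>k. coeff p k \<cdot>\<^sub>m M ^\<^sub>m k", OF triangular_in_basis_smult[OF pow]]
    by (simp add: poly_altdef)
qed

section \<open>Polynomial matrices under base change and transposition\<close>

interpretation to_ac: field_hom to_ac
  by unfold_locales auto

lemma poly_mat_carrier [simp]: "A \<in> carrier_mat n n \<Longrightarrow> poly_mat p A \<in> carrier_mat n n"
  unfolding poly_mat_def by auto

lemma map_mat_to_ac_poly_mat:
  assumes A: "A \<in> carrier_mat n n"
  shows "map_mat to_ac (poly_mat p A) = poly_mat (map_poly to_ac p) (map_mat to_ac A)"
proof (intro eq_matI)
  fix i j assume "i < dim_row (poly_mat (map_poly to_ac p) (map_mat to_ac A))"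
    "j < dim_col (poly_mat (map_poly to_ac p) (map_mat to_ac A))"
  then have ij: "i < n" "j < n" using A unfolding poly_mat_def by auto
  have "(map_mat to_ac A ^\<^sub>m k) $$ (i,j) = to_ac ((A ^\<^sub>m k) $$ (i,j))" for k
    using ij A by (simp flip: to_ac.mat_hom_pow[OF A])
  then show "map_mat to_ac (poly_mat p A) $$ (i,j) =
      poly_mat (map_poly to_ac p) (map_mat to_ac A) $$ (i,j)"
    using ij A unfolding poly_mat_def by (simp add: to_ac_sum coeff_map_poly)
qed (use A in \<open>auto simp: poly_mat_def\<close>)

text \<open>Transposing a power reverses the order of its factors, which is harmless since
  \<open>A\<close> commutes with its powers.\<close>

lemma transpose_poly_mat:
  fixes A :: "'a::comm_ring_1 mat"
  assumes A: "A \<in> carrier_mat n n" and sym: "transpose_mat A = A"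
  shows "transpose_mat (poly_mat p A) = poly_mat p A"
proof -
  have comm: "A * A ^\<^sub>m k = A ^\<^sub>m k * A" for k
  proof (induction k)
    case (Suc k)
    have "A * A ^\<^sub>m Suc k = A * A ^\<^sub>m k * A"
      using A by (simp add: assoc_mult_mat[of _ n n _ n _ n])
    then show ?case using Suc by simp
  qed (use A in simp)
  have pow: "transpose_mat (A ^\<^sub>m k) = A ^\<^sub>m k" for k
  proof (induction k)
    case (Suc k)
    have "transpose_mat (A ^\<^sub>m Suc k) = A * A ^\<^sub>m k"
      using transpose_mult[OF pow_carrier_mat[OF A] A] Suc sym by simp
    then show ?case using comm by simp
  qed (use A in simp)
  have "(A ^\<^sub>m k) $$ (j,i) = (A ^\<^sub>m k) $$ (i,j)" if "i < n" "j < n" for i j k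
    using arg_cong[OF pow, of "\<lambda>M. M $$ (i,j)" k] that A by simp
  then show ?thesis
    using A unfolding poly_mat_def by (intro eq_matI) auto
qed

section \<open>The Gram matrix of a block row and the hull\<close>

text \<open>The sum over all columns splits into runs of length \<open>n\<close>, one for each
  block, and each run is an entry of that block times its transpose.\<close>

lemma block_row_mult_transpose:
  fixes Bs :: "'a::comm_semiring_0 mat list"
  assumes Bs: "\<And>b. b < length Bs \<Longrightarrow> Bs ! b \<in> carrier_mat n n"
  shows "block_row n Bs * transpose_mat (block_row n Bs) =
    mat n n (\<lambda>(i,j). \<Sum>b<length Bs. (Bs ! b * transpose_mat (Bs ! b)) $$ (i,j))"
proof (intro eq_matI)
  let ?G = "block_row n Bs" and ?t = "length Bs"
  fix i j assume "i < dim_row (mat n n (\<lambda>(i,j). \<Sum>b<?t. (Bs ! b * transpose_mat (Bs ! b)) $$ (i,j)))"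
    "j < dim_col (mat n n (\<lambda>(i,j). \<Sum>b<?t. (Bs ! b * transpose_mat (Bs ! b)) $$ (i,j)))"
  then have ij: "i < n" "j < n" by auto
  have "(?G * transpose_mat ?G) $$ (i,j) = (\<Sum>c<?t * n. ?G $$ (i,c) * ?G $$ (j,c))"
    using ij by (simp add: block_row_def scalar_prod_def atLeast0LessThan)
  also have "\<dots> = (\<Sum>b<?t. \<Sum>c\<in>{b * n..<b * n + n}. ?G $$ (i,c) * ?G $$ (j,c))"
    by (rule sum.nat_group[symmetric])
  also have "\<dots> = (\<Sum>b<?t. (Bs ! b * transpose_mat (Bs ! b)) $$ (i,j))"
  proof (rule sum.cong[OF refl])
    fix b assume b: "b \<in> {..<?t}"
    \<comment> \<open>The column index has to be shown in range before the entry can be evaluated;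
      \<open>div\<close> and \<open>mod\<close> by \<open>n\<close> then return \<open>b\<close> and
      \<open>m\<close>.\<close>
    have entry: "?G $$ (k, m + b * n) = (Bs ! b) $$ (k, m)" if "k < n" "m < n" for k m
    proof -
      have "m + b * n < Suc b * n" using that by simp
      also have "\<dots> \<le> ?t * n" using b by (intro mult_le_mono1) auto
      finally show ?thesis using that unfolding block_row_def by simp
    qed
    have "(\<Sum>c\<in>{b * n..<b * n + n}. ?G $$ (i,c) * ?G $$ (j,c)) =
        (\<Sum>m\<in>{0..<n}. ?G $$ (i, m + b * n) * ?G $$ (j, m + b * n))"
      using sum.shift_bounds_nat_ivl[of "\<lambda>c. ?G $$ (i,c) * ?G $$ (j,c)" 0 "b * n" n]
      by (simp add: add.commute)
    also have "\<dots> = (\<Sum>m\<in>{0..<n}. (Bs ! b) $$ (i,m) * (Bs ! b) $$ (j,m))"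
      using entry ij by simp
    also have "\<dots> = (Bs ! b * transpose_mat (Bs ! b)) $$ (i,j)"
      using Bs[of b] b ij by (simp add: scalar_prod_def)
    finally show "(\<Sum>c\<in>{b * n..<b * n + n}. ?G $$ (i,c) * ?G $$ (j,c)) = \<dots>" .
  qed
  finally show "(?G * transpose_mat ?G) $$ (i,j) =
      mat n n (\<lambda>(i,j). \<Sum>b<?t. (Bs ! b * transpose_mat (Bs ! b)) $$ (i,j)) $$ (i,j)"
    using ij by simp
qed (auto simp: block_row_def)

text \<open>Codewords are \<open>?H *\<^sub>v x\<close>, and the inner product of two of them is
  \<open>u \<bullet> ((G * ?H) *\<^sub>v x)\<close>. Hence the hull is the image under the injective
  \<open>?H\<close> of the kernel of \<open>G * ?H\<close>, which is the line through
  \<open>v\<close>.\<close>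

lemma linear_code_generator_and_hull:
  fixes G :: "'a::field mat"
  assumes G: "G \<in> carrier_mat n N"
    and inj: "\<And>x. x \<in> carrier_vec n \<Longrightarrow> transpose_mat G *\<^sub>v x = 0\<^sub>v N \<Longrightarrow> x = 0\<^sub>v n"
    and v: "v \<in> carrier_vec n" "v \<noteq> 0\<^sub>v n" "(G * transpose_mat G) *\<^sub>v v = 0\<^sub>v n"
    and ker: "\<And>u. u \<in> carrier_vec n \<Longrightarrow> (G * transpose_mat G) *\<^sub>v u = 0\<^sub>v n \<Longrightarrow> \<exists>c. u = c \<cdot>\<^sub>v v"
  shows "linear_code N n (code_of_generator G)"
    and "linear_code N 1 (euclidean_hull N (code_of_generator G))"
proof -
  let ?H = "transpose_mat G"
  have H: "?H \<in> carrier_mat N n" using G by simp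
  have C: "code_of_generator G = {?H *\<^sub>v x |x. x \<in> carrier_vec n}"
    using vec_space.row_space_eq[of G n N] G unfolding code_of_generator_def by auto
  show "linear_code N n (code_of_generator G)"
    unfolding C by (rule linear_code_range[OF H inj])
  have dual: "?H *\<^sub>v x \<in> euclidean_dual N (code_of_generator G) \<longleftrightarrow> (G * ?H) *\<^sub>v x = 0\<^sub>v n"
    if x: "x \<in> carrier_vec n" for x
  proof -
    have prod: "(?H *\<^sub>v u) \<bullet> (?H *\<^sub>v x) = u \<bullet> ((G * ?H) *\<^sub>v x)" if "u \<in> carrier_vec n" for u
      using transpose_vec_mult_scalar[OF G _ that, of "?H *\<^sub>v x"] assoc_mult_mat_vec[OF G H x] H x
      by simp
    have GHx: "(G * ?H) *\<^sub>v x \<in> carrier_vec n" using G x by auto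
    \<comment> \<open>Testing against unit vectors shows that a vector orthogonal to everything is
      zero.\<close>
    have "((G * ?H) *\<^sub>v x) $ i = 0"
      if "\<forall>u\<in>carrier_vec n. u \<bullet> ((G * ?H) *\<^sub>v x) = 0" "i < n" for i
      using bspec[OF that(1), of "unit_vec n i"] scalar_prod_left_unit[OF GHx] that(2) by simp
    then have "(\<forall>u\<in>carrier_vec n. u \<bullet> ((G * ?H) *\<^sub>v x) = 0) \<longleftrightarrow> (G * ?H) *\<^sub>v x = 0\<^sub>v n"
      using GHx G by (auto intro!: eq_vecI)
    then show ?thesis
      unfolding euclidean_dual_def C using prod H x by auto
  qed
  \<comment> \<open>With the spanning codeword as its single column, \<open>W\<close> makes the hull
    a range, so that \<open>linear_code_range\<close> gives dimension 1.\<close>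
  define W where "W = mat_of_cols N [?H *\<^sub>v v]"
  have W: "W \<in> carrier_mat N 1" unfolding W_def using mat_of_cols_carrier(1)[of N "[?H *\<^sub>v v]"] by simp
  have Wx: "W *\<^sub>v x = ?H *\<^sub>v (x $ 0 \<cdot>\<^sub>v v)" if "x \<in> carrier_vec 1" for x
    using that H v
    by (intro eq_vecI) (auto simp: W_def mat_of_cols_def scalar_prod_def mult_mat_vec[OF H v(1)])
  have kernel: "(G * ?H) *\<^sub>v (c \<cdot>\<^sub>v v) = 0\<^sub>v n" for c
    using mult_mat_vec[OF mult_carrier_mat[OF G H] v(1)] v(3) by (auto intro!: eq_vecI)
  have hull: "euclidean_hull N (code_of_generator G) = {W *\<^sub>v x |x. x \<in> carrier_vec 1}"
  proof (intro equalityI subsetI)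
    fix y assume "y \<in> euclidean_hull N (code_of_generator G)"
    then obtain x where x: "x \<in> carrier_vec n" "y = ?H *\<^sub>v x" "(G * ?H) *\<^sub>v x = 0\<^sub>v n"
      using dual unfolding euclidean_hull_def C by auto
    then obtain c where "x = c \<cdot>\<^sub>v v" using ker by blast
    then have "y = W *\<^sub>v vec 1 (\<lambda>_. c)" using Wx[of "vec 1 (\<lambda>_. c)"] x(2) by simp
    then show "y \<in> {W *\<^sub>v x |x. x \<in> carrier_vec 1}" using vec_carrier by blast
  next
    fix y assume "y \<in> {W *\<^sub>v x |x. x \<in> carrier_vec 1}"
    then obtain c where y: "y = ?H *\<^sub>v (c \<cdot>\<^sub>v v)" using Wx by blast
    have cv: "c \<cdot>\<^sub>v v \<in> carrier_vec n" using v by simp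
    show "y \<in> euclidean_hull N (code_of_generator G)"
      using dual[OF cv] kernel cv unfolding y euclidean_hull_def by (subst (1) C) blast
  qed
  show "linear_code N 1 (euclidean_hull N (code_of_generator G))"
    unfolding hull
  proof (rule linear_code_range[OF W])
    fix x :: "'a vec" assume x: "x \<in> carrier_vec 1" and "W *\<^sub>v x = 0\<^sub>v N"
    then have "x $ 0 \<cdot>\<^sub>v v = 0\<^sub>v n" using inj[of "x $ 0 \<cdot>\<^sub>v v"] Wx v by simp
    moreover obtain i where i: "i < n" "v $ i \<noteq> 0" using nonzero_vec_entry[OF v(1,2)] by blast
    moreover have "(x $ 0 \<cdot>\<^sub>v v) $ i = x $ 0 * v $ i" using i v(1) by simp
    ultimately have "x $ 0 = 0" using i by simp
    then show "x = 0\<^sub>v 1" using x by (intro eq_vecI) auto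
  qed
qed

section \<open>The criterion for a one-dimensional hull\<close>

text \<open>Moves the distinguished eigenvalue to diagonal position 0, the only position where
  \<open>upper_triangular_kernel\<close> tolerates a zero. Permuting indices rather than values
  preserves multiplicities.\<close>

lemma lists_eigenvalues_permuted_prod_list:
  assumes "lists_eigenvalues n A lam" and "i \<in> {1..n}"
  shows "char_poly (map_mat to_ac A) =
    (\<Prod>e\<leftarrow>map lam (i # filter (\<lambda>j. j \<noteq> i) [1..<Suc n]). [:- e, 1:])"
proof -
  let ?idx = "i # filter (\<lambda>j. j \<noteq> i) [1..<Suc n]"
  have "distinct ?idx" by simp
  moreover have "set ?idx = {1..n}" using assms(2) by auto
  ultimately have "(\<Prod>j=1..n. [:- lam j, 1:]) = (\<Prod>j\<leftarrow>?idx. [:- lam j, 1:])"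
    by (metis prod.distinct_set_conv_list)
  then show ?thesis
    using assms(1) unfolding lists_eigenvalues_def by (simp add: o_def)
qed

text \<open>The hypothesis is the common form of both characteristic cases: the listed eigenvalues
  of the Gram matrix contain 0 exactly once.\<close>

lemma one_dimensional_hull_generator_matrix:
  fixes A :: "'a::field mat" and lam :: "nat \<Rightarrow> 'a alg_closure"
  assumes t: "t \<ge> 1" and A: "A \<in> carrier_mat n n" and sym: "transpose_mat A = A"
    and lam: "lists_eigenvalues n A lam"
    and ex1: "\<exists>!i. i \<in> {1..n} \<and> 1 + (\<Sum>k=1..t-1. (poly_ac (f k) (lam i))\<^sup>2) = 0"
  defines "C \<equiv> code_of_generator (generator_matrix n t f A)"
  shows "linear_code (t * n) n C \<and> linear_code (t * n) 1 (euclidean_hull (t * n) C)"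
proof -
  obtain i0 where i0: "i0 \<in> {1..n}" "1 + (\<Sum>k=1..t-1. (poly_ac (f k) (lam i0))\<^sup>2) = 0"
    and uniq: "\<And>i. i \<in> {1..n} \<Longrightarrow> 1 + (\<Sum>k=1..t-1. (poly_ac (f k) (lam i))\<^sup>2) = 0 \<Longrightarrow> i = i0"
    using ex1 by blast
  have n: "0 < n" using i0 by auto
  define Bs where "Bs = 1\<^sub>m n # map (\<lambda>k. poly_mat (f k) A) [1..<t]"
  define G where "G = generator_matrix n t f A"
  define S where "S = G * transpose_mat G"
  have len: "length Bs = t" using t by (simp add: Bs_def)
  have Bs_nth: "Bs ! b = (if b = 0 then 1\<^sub>m n else poly_mat (f b) A)" if "b < t" for b
    using that by (cases b) (auto simp: Bs_def)
  have G: "G \<in> carrier_mat n (t * n)"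
    unfolding G_def generator_matrix_def Bs_def[symmetric] block_row_def len by simp
  have S: "S \<in> carrier_mat n n" using G by (simp add: S_def)
  \<comment> \<open>Every block is symmetric, so its product with its transpose is its
    square.\<close>
  have S_eq: "S = mat n n (\<lambda>(i,j). \<Sum>b<t. (Bs ! b * Bs ! b) $$ (i,j))"
  proof -
    have "transpose_mat (Bs ! b) = Bs ! b" if "b < t" for b
      using Bs_nth[OF that] transpose_poly_mat[OF A sym] by simp
    then show ?thesis
      unfolding S_def G_def generator_matrix_def Bs_def[symmetric]
      using block_row_mult_transpose[of Bs n] len Bs_nth A
      by (auto intro!: eq_matI)
  qed

  define idx where "idx = i0 # filter (\<lambda>j. j \<noteq> i0) [1..<Suc n]"
  let ?A = "map_mat to_ac A"
  have A': "?A \<in> carrier_mat n n" using A by simp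
  obtain T P Q where wit: "similar_mat_wit ?A T P Q" and T: "upper_triangular T"
    "diag_mat T = map lam idx"
    using triangularization[OF A' lists_eigenvalues_permuted_prod_list[OF lam i0(1)]]
    unfolding idx_def by blast
  note w = similar_mat_witD2[OF A' wit]
  have len_idx: "length idx = n"
    using arg_cong[OF T(2), of length] w(5) by (simp add: diag_mat_def)
  have T_diag: "T $$ (i,i) = lam (idx ! i)" if "i < n" for i
    using arg_cong[OF T(2), of "\<lambda>xs. xs ! i"] that w(5) len_idx by (simp add: diag_mat_def)
  have triA: "triangular_in_basis n P Q ?A (\<lambda>i. lam (idx ! i))"
    unfolding triangular_in_basis_def using wit A' T T_diag by blast
  note PQ = w(6) w(7) w(1) w(2)
  \<comment> \<open>The diagonal of block \<open>b\<close> in the common basis; block 0 is the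
    identity and later contributes the summand 1.\<close>
  define d where "d b i = (if b = 0 then 1 else poly_ac (f b) (lam (idx ! i)))" for b i
  have tri: "triangular_in_basis n P Q (map_mat to_ac (Bs ! b)) (d b)" if "b < t" for b
    using triangular_in_basis_one[OF PQ]
      triangular_in_basis_poly_mat[OF PQ triA, of "map_poly to_ac (f b)"]
    unfolding Bs_nth[OF that] d_def
    by (auto simp: to_ac.mat_hom_one map_mat_to_ac_poly_mat[OF A] poly_ac_def)
  have Bs_carrier: "Bs ! b \<in> carrier_mat n n" if "b < t" for b
    using Bs_nth[OF that] A by simp
  have "map_mat to_ac S =
      mat n n (\<lambda>(i,j). \<Sum>b<t. (map_mat to_ac (Bs ! b) * map_mat to_ac (Bs ! b)) $$ (i,j))"
  proof (unfold S_eq, intro eq_matI)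
    fix i j
    assume "i < dim_row (mat n n (\<lambda>(i,j). \<Sum>b<t. (map_mat to_ac (Bs ! b) * map_mat to_ac (Bs ! b)) $$ (i,j)))"
      "j < dim_col (mat n n (\<lambda>(i,j). \<Sum>b<t. (map_mat to_ac (Bs ! b) * map_mat to_ac (Bs ! b)) $$ (i,j)))"
    then have ij: "i < n" "j < n" by auto
    have "to_ac ((Bs ! b * Bs ! b) $$ (i,j)) =
        (map_mat to_ac (Bs ! b) * map_mat to_ac (Bs ! b)) $$ (i,j)" if "b < t" for b
      using Bs_carrier[OF that] ij
      by (simp flip: to_ac.mat_hom_mult[OF Bs_carrier[OF that] Bs_carrier[OF that]])
    then show "map_mat to_ac (mat n n (\<lambda>(i,j). \<Sum>b<t. (Bs ! b * Bs ! b) $$ (i,j))) $$ (i,j) =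
        mat n n (\<lambda>(i,j). \<Sum>b<t. (map_mat to_ac (Bs ! b) * map_mat to_ac (Bs ! b)) $$ (i,j)) $$ (i,j)"
      using ij by (simp add: to_ac_sum)
  qed auto
  then have triS: "triangular_in_basis n P Q (map_mat to_ac S) (\<lambda>i. \<Sum>b<t. d b i * d b i)"
    using triangular_in_basis_sum[OF PQ finite_lessThan, of t, OF triangular_in_basis_mult] tri
    by simp
  have d_sum: "(\<Sum>b<t. d b i * d b i) = 1 + (\<Sum>k=1..t-1. (poly_ac (f k) (lam (idx ! i)))\<^sup>2)" for i
  proof -
    have "{..<t} = insert 0 {1..t-1}" using t by auto
    then show ?thesis by (simp add: d_def power2_eq_square)
  qed
  obtain D where D: "similar_mat_wit (map_mat to_ac S) D P Q" "upper_triangular D"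
    and D_diag: "\<And>i. i < n \<Longrightarrow>
      D $$ (i,i) = 1 + (\<Sum>k=1..t-1. (poly_ac (f k) (lam (idx ! i)))\<^sup>2)"
    using triS unfolding triangular_in_basis_def d_sum by blast
  have S': "map_mat to_ac S \<in> carrier_mat n n" using S by simp
  note D_carrier = similar_mat_witD2(5)[OF S' D(1)]
  have D0: "D $$ (0,0) = 0"
    using D_diag[OF n] i0(2) by (simp add: idx_def)
  have D_nz: "D $$ (i,i) \<noteq> 0" if "0 < i" "i < n" for i
  \<comment> \<open>Beyond position 0 the list \<open>idx\<close> avoids \<open>i0\<close>, so
    uniqueness excludes a zero.\<close>
  proof -
    have "idx ! i \<in> set (filter (\<lambda>j. j \<noteq> i0) [1..<Suc n])"
      using that len_idx nth_mem[of "i - 1" "filter (\<lambda>j. j \<noteq> i0) [1..<Suc n]"]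
      unfolding idx_def by (simp add: nth_Cons' del: set_filter upt_Suc)
    then show ?thesis using D_diag[OF that(2)] uniq by auto
  qed

  \<comment> \<open>The zero at the corner of \<open>D\<close> kills the determinant over the
    closure. It is the image of \<open>det S\<close> under an injective map, so a nonzero kernel
    vector exists already over the base field.\<close>
  have "det (map_mat to_ac S) = det D"
    using D(1) det_similar unfolding similar_mat_def by blast
  also have "\<dots> = 0"
    using det_upper_triangular[OF D(2) D_carrier] D0 n D_carrier
    by (force simp: prod_list_zero_iff diag_mat_def)
  finally have "det S = 0" by simp
  then obtain v where v: "v \<in> carrier_vec n" "v \<noteq> 0\<^sub>v n" "S *\<^sub>v v = 0\<^sub>v n"
    using det_0_iff_vec_prod_zero_field[OF S] by blast
  obtain p where p: "p < n" "v $ p \<noteq> 0"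
    using nonzero_vec_entry[OF v(1,2)] by blast
  have ker: "\<exists>c. u = c \<cdot>\<^sub>v v" if u: "u \<in> carrier_vec n" "S *\<^sub>v u = 0\<^sub>v n" for u
  proof -
    have zero: "map_vec to_ac (0\<^sub>v n :: 'a vec) = 0\<^sub>v n"
      by (intro eq_vecI) auto
    have *: "map_mat to_ac S *\<^sub>v map_vec to_ac x = 0\<^sub>v n"
      if "x \<in> carrier_vec n" "S *\<^sub>v x = 0\<^sub>v n" for x
      using to_ac.mult_mat_vec_hom[OF S that(1)] that(2) zero by simp
    have "map_vec to_ac v $ p \<noteq> 0" using p v(1) by simp
    then have "map_vec to_ac v \<noteq> 0\<^sub>v n" using p(1) by force
    then have "\<exists>c. map_vec to_ac u = c \<cdot>\<^sub>v map_vec to_ac v"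
      using kernel_similar_upper_triangular[OF D(1) S' D(2)] D_nz *[OF u] *[OF v(1,3)] u(1) v(1)
      by (metis map_carrier_vec)
    then obtain c where c: "map_vec to_ac u = c \<cdot>\<^sub>v map_vec to_ac v" ..
    have entry: "to_ac (u $ j) = c * to_ac (v $ j)" if "j < n" for j
      using arg_cong[OF c, of "\<lambda>w :: 'a alg_closure vec. w $ j"] that u v by simp
    \<comment> \<open>The factor \<open>c\<close> is only known to lie in the closure; the
      coordinate \<open>p\<close>, where \<open>v\<close> does not vanish, shows that it comes from
      the base field.\<close>
    have "c = to_ac (u $ p / v $ p)"
      using entry[OF p(1)] p(2) by simp
    then have "to_ac (u $ j) = to_ac (u $ p / v $ p * v $ j)" if "j < n" for j
      using entry[OF that] by simp
    then have "u = (u $ p / v $ p) \<cdot>\<^sub>v v"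
      using u v unfolding to_ac_eq_iff by (intro eq_vecI) auto
    then show ?thesis ..
  qed

  have inj: "x = 0\<^sub>v n" if x: "x \<in> carrier_vec n" "transpose_mat G *\<^sub>v x = 0\<^sub>v (t * n)" for x
  proof (intro eq_vecI)
    fix i assume "i < dim_vec (0\<^sub>v n :: 'a vec)"
    then have i: "i < n" by simp
    have "i < t * n" using i t by (metis less_le_trans mult_le_mono1 mult_1)
    then have "0 = (transpose_mat G *\<^sub>v x) $ i" using x by simp
    also have "\<dots> = col G i \<bullet> x" using \<open>i < t * n\<close> G by simp
    \<comment> \<open>The leading identity block makes the first \<open>n\<close> entries of the
      codeword equal to those of \<open>x\<close>.\<close>
    also have "col G i = unit_vec n i"
      using i \<open>i < t * n\<close> G len
      by (intro eq_vecI) (auto simp: G_def generator_matrix_def block_row_def)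
    finally show "x $ i = 0\<^sub>v n $ i" using x i by simp
  qed (use x in auto)
  note result = linear_code_generator_and_hull[OF G _ v(1,2), folded S_def, OF _ v(3)]
  show ?thesis
    unfolding C_def G_def[symmetric] by (intro conjI result) (use inj ker in blast)+
qed

section \<open>Even and odd characteristic\<close>

theorem theorem3p4:
  fixes A :: "'a::{field,finite} mat" and f :: "nat \<Rightarrow> 'a poly"
    and lam :: "nat \<Rightarrow> 'a alg_closure" and n t :: nat and C :: "'a vec set"
  assumes "n \<ge> 1" and "t \<ge> 2"
    and "A \<in> carrier_mat n n" and "transpose_mat A = A"
    and "lists_eigenvalues n A lam"
    and "C = code_of_generator (generator_matrix n t f A)"
  shows
    "(even CHAR('a) \<longrightarrow>
        (\<exists>!i. i \<in> {1..n} \<and> (\<Sum>k=1..t-1. poly_ac (f k) (lam i)) = 1) \<longrightarrow>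
        linear_code (t * n) n C \<and> linear_code (t * n) 1 (euclidean_hull (t * n) C))
     \<and>
     (odd CHAR('a) \<longrightarrow>
        ((\<exists>!i. i \<in> {1..n} \<and> (\<Sum>k=1..t-1. (poly_ac (f k) (lam i))\<^sup>2) = -1) \<longrightarrow>
           linear_code (t * n) n C \<and> linear_code (t * n) 1 (euclidean_hull (t * n) C))
        \<and>
        (\<forall>\<mu> \<in> quadratic_extension. t = 2 \<longrightarrow> \<mu>\<^sup>2 = -1 \<longrightarrow>
           (\<exists>!i. i \<in> {1..n} \<and> poly_ac (f 1) (lam i) \<in> {\<mu>, -\<mu>}) \<longrightarrow>
           linear_code (2 * n) n C \<and> linear_code (2 * n) 1 (euclidean_hull (2 * n) C)))"
proof -
  let ?g = "\<lambda>i. 1 + (\<Sum>k=1..t-1. (poly_ac (f k) (lam i))\<^sup>2)"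
  let ?claim = "linear_code (t * n) n C \<and> linear_code (t * n) 1 (euclidean_hull (t * n) C)"
  have main: "?claim" if "\<exists>!i. i \<in> {1..n} \<and> ?g i = 0"
    unfolding assms(6)
    by (rule one_dimensional_hull_generator_matrix[OF _ assms(3-5) that]) (use assms(2) in simp)
  have iff: "?g i = 0 \<longleftrightarrow> (\<Sum>k=1..t-1. poly_ac (f k) (lam i)) = 1" if "even CHAR('a)" for i
  proof -
    \<comment> \<open>A finite field has positive, hence prime, characteristic, and the only even
      prime is 2.\<close>
    have "prime CHAR('a)"
      by (simp add: prime_CHAR_semidom finite_imp_CHAR_pos)
    then have "CHAR('a) = 2"
      by (rule primes_dvd_imp_eq[OF two_is_prime_nat _ that, symmetric])
    then have char2: "CHAR('a alg_closure) = 2" by simp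
    have two: "(2 :: 'a alg_closure) = 0"
      using of_nat_CHAR[where ?'a = "'a alg_closure"] unfolding char2 by simp
    have sq: "(x + y)\<^sup>2 = x\<^sup>2 + y\<^sup>2" for x y :: "'a alg_closure"
      by (simp add: power2_sum two)
    have sum_sq: "(\<Sum>k\<in>K. (h k)\<^sup>2) = (\<Sum>k\<in>K. h k)\<^sup>2"
      for K :: "nat set" and h :: "nat \<Rightarrow> 'a alg_closure"
      by (induction K rule: infinite_finite_induct) (auto simp: sq)
    \<comment> \<open>Squaring is additive in characteristic 2, so the sum of squares is a square;
      its root vanishes iff the sum is -1, which equals 1.\<close>
    have "?g i = (1 + (\<Sum>k=1..t-1. poly_ac (f k) (lam i)))\<^sup>2"
      by (simp only: sq sum_sq one_power2)
    then have "?g i = 0 \<longleftrightarrow> (\<Sum>k=1..t-1. poly_ac (f k) (lam i)) = - 1"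
      by (simp add: add_eq_0_iff)
    then show ?thesis
      using uminus_CHAR_2[OF char2, of 1] by simp
  qed
  have even: "?claim" if "even CHAR('a)"
      "\<exists>!i. i \<in> {1..n} \<and> (\<Sum>k=1..t-1. poly_ac (f k) (lam i)) = 1"
    using that(2) unfolding iff[OF that(1), symmetric] by (rule main)
  have odd: "?claim" if "\<exists>!i. i \<in> {1..n} \<and> (\<Sum>k=1..t-1. (poly_ac (f k) (lam i))\<^sup>2) = -1"
    by (rule main) (use that in \<open>simp only: add_eq_0_iff\<close>)
  have two_blocks: "?claim" if "t = 2" "\<mu>\<^sup>2 = -1" "\<exists>!i. i \<in> {1..n} \<and> poly_ac (f 1) (lam i) \<in> {\<mu>, -\<mu>}" for \<mu>
  proof -
    \<comment> \<open>For \<open>t = 2\<close> the sum has one term; with -1 rewritten as the square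
      of \<mu>, equality of squares means equality up to sign.\<close>
    have "poly_ac (f 1) (lam i) \<in> {\<mu>, -\<mu>} \<longleftrightarrow> (\<Sum>k=1..t-1. (poly_ac (f k) (lam i))\<^sup>2) = -1" for i
      using that(1) by (simp add: power2_eq_iff flip: that(2))
    then show ?thesis using that(3) by (intro odd) (simp only:)
  qed
  show ?thesis
  proof (intro conjI impI ballI, goal_cases)
    case 1 then show ?case using even by blast
  next
    case 2 then show ?case using even by blast
  next
    case 3 then show ?case using odd by blast
  next
    case 4 then show ?case using odd by blast
  next
    case (5 \<mu>) then show ?case using two_blocks[of \<mu>] by simp
  next
    case (6 \<mu>) then show ?case using two_blocks[of \<mu>] by simp
  qed
qed

end
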